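(* Let $\theta\in\mathbb{R}\setminus\mathbb{Q}$ be a quadratic irrational. For each $n\ge 0$ let $p_n/q_n$ denote the $n$th best rational approximant (i.e. the $n$th continued fraction convergent) of $\theta$. Then the generating functions $$F(z)=\sum_{n\ge 0}p_nz^n\qquad\text{and}\qquad G(z)=\sum_{n\ge 0}q_nz^n$$ are both rational functions of $z$ with integer coefficients, i.e. each is equal (as a power series) to a quotient of two polynomials in $\mathbb{Z}[z]$.
   Context: A quadratic irrational is a real algebraic number of degree exactly two. Every irrational real $\theta$ has a simple continued fraction expansion $\theta=a_0+\cfrac{1}{a_1+\cfrac{1}{a_2+\cdots}}$ with $a_0=\lfloor\theta\rfloor\in\mathbb{Z}$ and $a_n$ a positive integer for $n\ge1$. The numerators and denominators of the convergents are given by $p_0=a_0$, $q_0=1$, $p_1=a_0a_1+1$, $q_1=a_1$, and $p_n=a_np_{n-1}+p_{n-2}$, $q_n=a_nq_{n-1}+q_{n-2}$ for $n\ge 2$. (For $\theta\in[0,1]$ one has $a_0=0$, $p_0=0$, $p_1=1$.) *)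

theory Defs
  imports Complex_Main "HOL-Computational_Algebra.Computational_Algebra"
begin

text \<open>
  The least degree of a nonzero rational polynomial vanishing at \<open>x\<close>, i.e. the degree of the
  minimal polynomial of \<open>x\<close> over the rationals. It is meaningful only for algebraic \<open>x\<close>
  (otherwise \<open>LEAST\<close> ranges over the empty set).
\<close>
definition algebraic_degree :: "real \<Rightarrow> nat" where
  "algebraic_degree x =
     (LEAST d. \<exists>p :: rat poly. p \<noteq> 0 \<and> degree p = d \<and> poly (map_poly of_rat p) x = 0)"

definition quadratic_irrational :: "real \<Rightarrow> bool" where
  "quadratic_irrational x \<longleftrightarrow> algebraic x \<and> algebraic_degree x = 2"

text \<open>
  The complete quotients of the continued fraction algorithm. For irrational arguments every
  complete quotient is irrational, so the division below is never by zero; for rational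
  arguments the expansion is finite and the later values are junk.
\<close>
primrec cf_complete_quotient :: "real \<Rightarrow> nat \<Rightarrow> real" where
  "cf_complete_quotient x 0 = x"
| "cf_complete_quotient x (Suc n) =
     1 / (cf_complete_quotient x n - of_int \<lfloor>cf_complete_quotient x n\<rfloor>)"

definition cf_partial_quotient :: "real \<Rightarrow> nat \<Rightarrow> int" where
  "cf_partial_quotient x n = \<lfloor>cf_complete_quotient x n\<rfloor>"

fun cf_num :: "real \<Rightarrow> nat \<Rightarrow> int" where
  "cf_num x 0 = cf_partial_quotient x 0"
| "cf_num x (Suc 0) = cf_partial_quotient x 0 * cf_partial_quotient x 1 + 1"
| "cf_num x (Suc (Suc n)) =
     cf_partial_quotient x (Suc (Suc n)) * cf_num x (Suc n) + cf_num x n"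

fun cf_denom :: "real \<Rightarrow> nat \<Rightarrow> int" where
  "cf_denom x 0 = 1"
| "cf_denom x (Suc 0) = cf_partial_quotient x 1"
| "cf_denom x (Suc (Suc n)) =
     cf_partial_quotient x (Suc (Suc n)) * cf_denom x (Suc n) + cf_denom x n"

definition generating_function :: "(nat \<Rightarrow> int) \<Rightarrow> rat fps" where
  "generating_function a = Abs_fps (\<lambda>n. of_int (a n))"

text \<open>
  The condition on the constant coefficient says that \<open>Q\<close> is a unit of the ring of formal power
  series over the rationals, so that \<open>/\<close> is genuine division there.
\<close>
definition rational_over_int :: "rat fps \<Rightarrow> bool" where
  "rational_over_int F \<longleftrightarrow>
     (\<exists>P Q :: int poly. coeff Q 0 \<noteq> 0 \<and>
        F = fps_of_poly (map_poly of_int P) / fps_of_poly (map_poly of_int Q))"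

end

theory Submission
  imports Defs
begin

text \<open>
  The proof has two halves: Lagrange's theorem that the continued fraction of a quadratic
  irrational is eventually periodic, and the fact that a second-order linear recurrence with
  eventually periodic coefficients can be replaced by one with constant coefficients.

  For the first half, an integral quadratic equation \<open>A x\<^sup>2 + B x + C = 0\<close> for one complete
  quotient is turned by the substitution \<open>x = a + 1 / y\<close> into one for the next complete quotient
  \<open>y\<close>, with the same discriminant. Once \<open>A * C < 0\<close>, this stays so
  (\<open>opposite_signs_step\<close>), and then \<open>B\<^sup>2 + 4 * \<bar>A * C\<bar>\<close> is the fixed discriminant, so that only
  finitely many equations occur. Each of them has only one positive root, hence a complete
  quotient recurs (\<open>cf_complete_quotient_recurs\<close>). The situation \<open>A * C < 0\<close> must arise, for as long as \<open>A * C > 0\<close> the positive integer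
  \<open>\<bar>B\<bar>\<close> strictly decreases (\<open>same_signs_step\<close>). This replaces the usual estimates on convergents
  or on conjugates by a descent in the integers.

  For the second half, let \<open>k\<close> be a period of the partial quotients from the index \<open>m\<close> on. Passing
  from \<open>u m, u (m + 1)\<close> to the values \<open>k\<close> places later is multiplication by an integral two-by-two
  matrix, and advancing by \<open>k\<close> once more is multiplication by the same matrix. By Cayley and
  Hamilton \<open>u (n + 2 * k) - T * u (n + k) + d * u n\<close> vanishes for \<open>n = m\<close> and \<open>n = m + 1\<close>, where \<open>T\<close> and \<open>d\<close>
  are trace and determinant. By periodicity this expression again satisfies the recurrence of \<open>u\<close>,
  so it vanishes at all later indices too (\<open>periodic_recurrence_constant_coeffs\<close>), and
  \<open>1 - T z\<^sup>k + d z\<^bsup>2k\<^esup>\<close> is a denominator of the generating function.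
\<close>

section \<open>Quadratic equations under a continued fraction step\<close>

lemma quadratic_irrational_imp_int_quadratic:
  assumes "quadratic_irrational x"
  obtains A B C :: int where "A \<noteq> 0" "of_int A * x\<^sup>2 + of_int B * x + of_int C = 0"
proof -
  have alg: "algebraic x" and deg: "algebraic_degree x = 2"
    using assms by (auto simp: quadratic_irrational_def)
  have "\<exists>d. \<exists>p :: rat poly. p \<noteq> 0 \<and> degree p = d \<and> poly (map_poly of_rat p) x = 0"
  proof -
    obtain p where p: "\<And>i. coeff p i \<in> \<rat>" "p \<noteq> 0" "poly p x = 0"
      using alg unfolding algebraic_altdef by blast
    obtain q where q: "p = map_poly of_rat q" using ratpolyE[of p] p(1) by blast
    with p(2) have "q \<noteq> 0" by auto
    with p(3) show ?thesis unfolding q by blast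
  qed
  from LeastI_ex[OF this] obtain p :: "rat poly" where
    p: "degree p = 2" "poly (map_poly of_rat p) x = 0"
    using deg unfolding algebraic_degree_def by auto
  define c where "c i = fst (quotient_of (coeff p i))" for i
  define e where "e i = snd (quotient_of (coeff p i))" for i
  have e: "e i > 0" for i unfolding e_def by (rule quotient_of_denom_pos')
  have ce: "coeff p i = of_int (c i) / of_int (e i)" for i
    unfolding c_def e_def by (simp add: quotient_of_div)
  have "c 2 \<noteq> 0" using p(1) ce[of 2] by (metis coeff_0 degree_0 div_0 leading_coeff_0_iff of_int_0 zero_neq_numeral)
  have "poly (map_poly of_rat p) x = (\<Sum>i\<le>2. of_rat (coeff p i) * x ^ i)"
    unfolding poly_altdef using p(1) by (simp add: coeff_map_poly degree_map_poly)
  also have "\<dots> = of_int (c 0) / of_int (e 0) + of_int (c 1) / of_int (e 1) * x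
      + of_int (c 2) / of_int (e 2) * x\<^sup>2"
    by (simp add: ce numeral_2_eq_2 of_rat_divide)
  finally have "of_int (c 0) / of_int (e 0) + of_int (c 1) / of_int (e 1) * x
      + of_int (c 2) / of_int (e 2) * x\<^sup>2 = 0" using p(2) by simp
  hence "of_int (c 2 * e 0 * e 1) * x\<^sup>2 + of_int (c 1 * e 0 * e 2) * x + of_int (c 0 * e 1 * e 2) = 0"
    using e[of 0] e[of 1] e[of 2] by (simp add: field_simps)
  moreover have "c 2 * e 0 * e 1 \<noteq> 0" using \<open>c 2 \<noteq> 0\<close> e[of 0] e[of 1] by simp
  ultimately show thesis using that by blast
qed

text \<open>
  An integral root would force the other root to be rational too. This keeps
  the leading coefficients of the transformed equations from vanishing.
\<close>
lemma quadratic_no_int_root: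
  fixes x :: real and A B C a :: int
  assumes "x \<notin> \<rat>" "A \<noteq> 0" and root: "of_int A * x\<^sup>2 + of_int B * x + of_int C = 0"
  shows "A * a\<^sup>2 + B * a + C \<noteq> 0"
proof
  assume "A * a\<^sup>2 + B * a + C = 0"
  hence "of_int A * (of_int a)\<^sup>2 + of_int B * of_int a + of_int C = (0::real)"
    by (metis of_int_0 of_int_add of_int_mult of_int_power)
  with root have "(x - of_int a) * (of_int A * (x + of_int a) + of_int B) = 0"
    by (simp add: algebra_simps power2_eq_square)
  moreover have "x \<noteq> of_int a" using assms(1) by auto
  ultimately have "of_int A * (x + of_int a) = - of_int B" by simp
  hence "x + of_int a = - of_int B / of_int A"
    using assms(2) by (metis nonzero_mult_div_cancel_left of_int_eq_0_iff)
  hence "x = - of_int B / of_int A - of_int a" by linarith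
  hence "x \<in> \<rat>" by simp
  with assms(1) show False ..
qed

lemma quadratic_substitute_inverse:
  fixes x y A B C a :: real
  assumes "A * x\<^sup>2 + B * x + C = 0" "x \<noteq> a" "y = 1 / (x - a)"
  shows "(A * a\<^sup>2 + B * a + C) * y\<^sup>2 + (2 * A * a + B) * y + A = 0"
proof -
  have y: "y \<noteq> 0" "x = a + 1 / y" using assms(2,3) by simp_all
  have "0 = y\<^sup>2 * (A * (a + 1 / y)\<^sup>2 + B * (a + 1 / y) + C)"
    using assms(1) y(2) by simp
  also have "\<dots> = (A * a\<^sup>2 + B * a + C) * y\<^sup>2 + (2 * A * a + B) * y + A"
    using y(1) by (simp add: field_simps power2_eq_square)
  finally show ?thesis by simp
qed

text \<open>
  If \<open>A * C < 0\<close>, the roots have opposite signs, so no sign change occurs between \<open>0\<close> and the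
  positive root \<open>x\<close>: the value at \<open>a\<close> has the sign of \<open>C\<close>. The conclusion says that the
  transformed equation, with leading coefficient \<open>A * a\<^sup>2 + B * a + C\<close> and constant coefficient
  \<open>A\<close>, again has roots of opposite signs.
\<close>
lemma opposite_signs_step:
  fixes x A B C a :: real
  assumes "A * x\<^sup>2 + B * x + C = 0" "A * C < 0" "0 \<le> a" "a < x"
  shows "(A * a\<^sup>2 + B * a + C) * A < 0"
proof -
  \<comment> \<open>Eliminating \<open>B\<close> between the values at \<open>a\<close> and at the root \<open>x\<close> makes the sign visible.\<close>
  have "x * ((A * a\<^sup>2 + B * a + C) * A)
      = a * A * (A * x\<^sup>2 + B * x + C) + (x - a) * (A * C - A\<^sup>2 * (a * x))"
    by (simp add: algebra_simps power2_eq_square)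
  also have "\<dots> = (x - a) * (A * C - A\<^sup>2 * (a * x))" using assms(1) by simp
  also have "\<dots> < 0"
  proof (rule mult_pos_neg)
    have "0 \<le> A\<^sup>2 * (a * x)" using assms(3,4) by simp
    thus "A * C - A\<^sup>2 * (a * x) < 0" using assms(2) by linarith
  qed (use assms(4) in simp)
  finally show ?thesis using assms(3,4) by (simp add: mult_less_0_iff)
qed

lemma quadratic_middle_sign:
  fixes x A B C :: real
  assumes "A * x\<^sup>2 + B * x + C = 0" "A * C > 0" "x > 0"
  shows "A * B < 0"
proof -
  have "(A * B) * x = A * (A * x\<^sup>2 + B * x + C) - A\<^sup>2 * x\<^sup>2 - A * C"
    by (simp add: algebra_simps power2_eq_square)
  also have "\<dots> = - (A\<^sup>2 * x\<^sup>2) - A * C" using assms(1) by simp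
  also have "\<dots> < 0"
  proof -
    have "0 \<le> A\<^sup>2 * x\<^sup>2" by simp
    with assms(2) show ?thesis by linarith
  qed
  finally show ?thesis using assms(3) by (simp add: mult_less_0_iff)
qed

text \<open>
  When all roots before and after the step are positive, the outer coefficients have one common
  sign and the middle coefficients \<open>B\<close> and \<open>B + 2 * A * a\<close> both have the other, so adding
  \<open>2 * A * a\<close> moves \<open>B\<close> towards \<open>0\<close> without crossing it.
\<close>
lemma same_signs_step:
  fixes x y :: real and A B C A' B' a :: int
  assumes root: "of_int A * x\<^sup>2 + of_int B * x + of_int C = 0"
    and root': "of_int A' * y\<^sup>2 + of_int B' * y + of_int A = 0"
    and B': "B' = 2 * A * a + B"
    and pos: "x > 0" "y > 0" "a > 0" and sgn: "A * C > 0" "A' * A > 0"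
  shows "\<bar>B'\<bar> < \<bar>B\<bar>"
proof -
  have "real_of_int A * real_of_int C > 0" "real_of_int A' * real_of_int A > 0"
    using sgn by (metis of_int_0_less_iff of_int_mult)+
  from quadratic_middle_sign[OF root this(1) pos(1)] quadratic_middle_sign[OF root' this(2) pos(2)]
  have "A * B < 0" "A' * B' < 0" by (metis of_int_less_0_iff of_int_mult)+
  with sgn pos(3) show ?thesis unfolding B'
    by (auto simp: mult_less_0_iff zero_less_mult_iff abs_if)
qed

lemma opposite_signs_unique_pos_root:
  fixes x y A B C :: real
  assumes "A * x\<^sup>2 + B * x + C = 0" "A * y\<^sup>2 + B * y + C = 0" "A * C < 0" "x > 0" "y > 0"
  shows "x = y"
proof (rule ccontr)
  assume "x \<noteq> y"
  moreover have "(x - y) * (A * (x + y) + B) = 0"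
    using assms(1,2) by (simp add: algebra_simps power2_eq_square)
  ultimately have B: "B = - A * (x + y)" by simp
  have "C = A * (x * y)" using assms(1) unfolding B by (simp add: algebra_simps power2_eq_square)
  hence "A * C = A\<^sup>2 * (x * y)" by (simp add: power2_eq_square)
  also have "\<dots> \<ge> 0" using assms(4,5) by simp
  finally show False using assms(3) by simp
qed

section \<open>Periodicity of the continued fraction of a quadratic irrational\<close>

lemma cf_complete_quotient_irrational:
  assumes "x \<notin> \<rat>"
  shows "cf_complete_quotient x n \<notin> \<rat>"
proof (induction n)
  case (Suc n)
  let ?z = "cf_complete_quotient x n"
  show ?case
  proof
    assume "cf_complete_quotient x (Suc n) \<in> \<rat>"
    hence "of_int \<lfloor>?z\<rfloor> + 1 / cf_complete_quotient x (Suc n) \<in> \<rat>"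
      by (intro Rats_add Rats_divide Rats_of_int Rats_1)
    also have "of_int \<lfloor>?z\<rfloor> + 1 / cf_complete_quotient x (Suc n) = ?z" by simp
    finally show False using Suc by simp
  qed
qed (use assms in simp)

lemma cf_complete_quotient_frac:
  assumes "x \<notin> \<rat>"
  shows "of_int (cf_partial_quotient x n) < cf_complete_quotient x n"
    and "cf_complete_quotient x n < of_int (cf_partial_quotient x n) + 1"
  using cf_complete_quotient_irrational[OF assms, of n] unfolding cf_partial_quotient_def
  by (metis Rats_of_int of_int_floor_le order_le_less) linarith

lemma cf_complete_quotient_gt_1:
  assumes "x \<notin> \<rat>"
  shows "cf_complete_quotient x (Suc n) > 1"
proof -
  let ?z = "cf_complete_quotient x n"
  have "0 < ?z - of_int \<lfloor>?z\<rfloor>" "?z - of_int \<lfloor>?z\<rfloor> < 1"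
    using cf_complete_quotient_frac[OF assms, of n] unfolding cf_partial_quotient_def
    by linarith+
  thus ?thesis by (simp only: cf_complete_quotient.simps less_divide_eq_1_pos)
qed

lemma cf_partial_quotient_pos:
  assumes "x \<notin> \<rat>"
  shows "cf_partial_quotient x (Suc n) > 0"
  using cf_complete_quotient_gt_1[OF assms, of n] unfolding cf_partial_quotient_def
  by linarith

text \<open>
  The coefficients of the equation that \<open>cf_complete_quotient x n\<close> inherits from the equation of
  \<open>x\<close> with coefficients \<open>t\<close>.
\<close>
primrec cf_quadratic :: "real \<Rightarrow> int \<times> int \<times> int \<Rightarrow> nat \<Rightarrow> int \<times> int \<times> int" where
  "cf_quadratic x t 0 = t"
| "cf_quadratic x t (Suc n) =
     (case cf_quadratic x t n of (A, B, C) \<Rightarrow>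
        (A * (cf_partial_quotient x n)\<^sup>2 + B * cf_partial_quotient x n + C,
         2 * A * cf_partial_quotient x n + B, A))"

lemma cf_complete_quotient_periodic:
  assumes "cf_complete_quotient x (m + k) = cf_complete_quotient x m" "n \<ge> m"
  shows "cf_complete_quotient x (n + k) = cf_complete_quotient x n"
  using assms(2,1) by (induction n rule: dec_induct) simp_all

text \<open>
  Lagrange's theorem. The sign pattern \<open>A * C > 0\<close> cannot persist by descent on \<open>\<bar>B\<bar>\<close>. Once
  \<open>A * C < 0\<close>, the invariance of the discriminant bounds the coefficients, and an equation that
  occurs twice has the same positive root both times.
\<close>
theorem cf_complete_quotient_recurs:
  assumes irr: "x \<notin> \<rat>" and quad: "quadratic_irrational x"
  obtains m k where "k > 0" "cf_complete_quotient x (m + k) = cf_complete_quotient x m"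
proof -
  let ?x = "cf_complete_quotient x" and ?a = "cf_partial_quotient x"
  obtain A0 B0 C0 :: int where
    t: "A0 \<noteq> 0" "of_int A0 * x\<^sup>2 + of_int B0 * x + of_int C0 = 0"
    using quadratic_irrational_imp_int_quadratic[OF quad] .
  define F where "F n = cf_quadratic x (A0, B0, C0) n" for n
  define A B C where "A n = fst (F n)" and "B n = fst (snd (F n))" and "C n = snd (snd (F n))" for n
  have A_Suc: "A (Suc n) = A n * (?a n)\<^sup>2 + B n * ?a n + C n"
    and B_Suc: "B (Suc n) = 2 * A n * ?a n + B n" and C_Suc: "C (Suc n) = A n" for n
    by (simp_all add: A_def B_def C_def F_def split: prod.split)
  have ne: "?x n \<noteq> of_int (?a n)" for n
    using cf_complete_quotient_frac(1)[OF irr, of n] by simp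
  have root: "of_int (A n) * (?x n)\<^sup>2 + of_int (B n) * ?x n + of_int (C n) = 0" for n
  proof (induction n)
    case 0
    show ?case using t(2) by (simp add: A_def B_def C_def F_def)
  next
    case (Suc n)
    from quadratic_substitute_inverse[OF Suc ne[of n], of "?x (Suc n)"]
    show ?case by (simp add: A_Suc B_Suc C_Suc cf_partial_quotient_def)
  qed
  have A_nz: "A n \<noteq> 0" for n
  proof (induction n)
    case 0
    show ?case using t(1) by (simp add: A_def F_def)
  next
    case (Suc n)
    show ?case unfolding A_Suc
      by (rule quadratic_no_int_root[OF cf_complete_quotient_irrational[OF irr] Suc root])
  qed
  define D where "D = (B 0)\<^sup>2 - 4 * A 0 * C 0"
  have disc: "(B n)\<^sup>2 - 4 * A n * C n = D" for n
  proof (induction n)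
    case (Suc n)
    have "(B (Suc n))\<^sup>2 - 4 * A (Suc n) * C (Suc n) = (B n)\<^sup>2 - 4 * A n * C n"
      by (simp add: A_Suc B_Suc C_Suc algebra_simps power2_eq_square)
    with Suc show ?case by simp
  qed (simp add: D_def)
  have pos: "?x (Suc n) > 0" for n
    using cf_complete_quotient_gt_1[OF irr, of n] by linarith
  have "\<exists>N. A (Suc N) * C (Suc N) < 0"
  proof (rule ccontr)
    assume "\<not> ?thesis"
    hence sgn: "A (Suc n) * C (Suc n) > 0" for n
      using A_nz[of n] A_nz[of "Suc n"] by (metis C_Suc linorder_neqE_linordered_idom mult_eq_0_iff)
    have dec: "\<bar>B (Suc (Suc n))\<bar> < \<bar>B (Suc n)\<bar>" for n
    proof (rule same_signs_step[OF root _ B_Suc pos pos cf_partial_quotient_pos[OF irr] sgn])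
      show "A (Suc (Suc n)) * A (Suc n) > 0" using sgn[of "Suc n"] by (simp add: C_Suc)
      show "of_int (A (Suc (Suc n))) * (?x (Suc (Suc n)))\<^sup>2
          + of_int (B (Suc (Suc n))) * ?x (Suc (Suc n)) + of_int (A (Suc n)) = 0"
        using root[of "Suc (Suc n)"] by (simp only: C_Suc)
    qed
    have "int n + \<bar>B (Suc n)\<bar> \<le> \<bar>B 1\<bar>" for n
    proof (induction n)
      case (Suc n)
      with dec[of n] show ?case by linarith
    qed simp
    from this[of "Suc (nat \<bar>B 1\<bar>)"] show False by linarith
  qed
  then obtain N where N: "A (Suc N) * C (Suc N) < 0" ..
  have neg: "A (Suc n) * C (Suc n) < 0" if "n \<ge> N" for n
    using that
  proof (induction n rule: dec_induct)
    case base
    show ?case by (rule N)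
  next
    case (step n)
    have "real_of_int (A (Suc n)) * real_of_int (C (Suc n)) < 0"
      using step.IH by (metis of_int_less_0_iff of_int_mult)
    from opposite_signs_step[OF root this, of "of_int (?a (Suc n))"]
    have "real_of_int (A (Suc (Suc n)) * C (Suc (Suc n))) < 0"
      using cf_partial_quotient_pos[OF irr, of n] cf_complete_quotient_frac(1)[OF irr, of "Suc n"]
      by (simp add: A_Suc[of "Suc n"] C_Suc[of "Suc n"])
    thus ?case by (simp only: of_int_less_0_iff)
  qed
  have bounded: "F n \<in> {-D..D} \<times> {-D..D} \<times> {-D..D}" if n: "n \<ge> Suc N" for n
  proof -
    from n obtain l where l: "n = Suc l" "l \<ge> N" by (cases n) auto
    have AC: "A n * C n < 0" using neg[OF l(2)] l(1) by simp
    hence "\<bar>A n\<bar> * \<bar>C n\<bar> = - (A n * C n)" by (metis abs_mult abs_of_neg)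
    hence eq: "(B n)\<^sup>2 + 4 * (\<bar>A n\<bar> * \<bar>C n\<bar>) = D" using disc[of n] by linarith
    have "A n \<noteq> 0" "C n \<noteq> 0" using AC by auto
    hence "\<bar>A n\<bar> \<le> \<bar>A n\<bar> * \<bar>C n\<bar>" "\<bar>C n\<bar> \<le> \<bar>A n\<bar> * \<bar>C n\<bar>"
      by (simp_all add: mult_le_cancel_left1 mult_le_cancel_right1)
    moreover have "\<bar>B n\<bar> \<le> (B n)\<^sup>2"
      by (metis abs_ge_zero abs_mult_self_eq int_one_le_iff_zero_less linorder_not_less mult_cancel_left1
          mult_le_cancel_left1 order_le_less power2_eq_square)
    ultimately have "\<bar>A n\<bar> \<le> D" "\<bar>B n\<bar> \<le> D" "\<bar>C n\<bar> \<le> D"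
      using eq zero_le_power2[of "B n"] by linarith+
    thus ?thesis by (auto simp: A_def B_def C_def mem_Times_iff)
  qed
  have "finite (F ` {Suc N..})"
    by (rule finite_subset[of _ "{-D..D} \<times> {-D..D} \<times> {-D..D}"]) (use bounded in blast, simp)
  hence "\<not> inj_on F {Suc N..}" using infinite_Ici finite_imageD by blast
  then obtain i j where ij: "i \<ge> Suc N" "i < j" "F i = F j"
    unfolding inj_on_def by (metis atLeast_iff linorder_neqE_nat)
  obtain i' j' where S: "i = Suc i'" "j = Suc j'" "i' \<ge> N" using ij by (cases i; cases j) auto
  have "?x j = ?x i"
  proof (rule opposite_signs_unique_pos_root)
    show "of_int (A i) * (?x j)\<^sup>2 + of_int (B i) * ?x j + of_int (C i) = 0"
      using root[of j] ij(3) by (simp add: A_def B_def C_def)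
    show "real_of_int (A i) * real_of_int (C i) < 0"
      using neg[OF S(3)] unfolding S(1) by (metis of_int_less_0_iff of_int_mult)
  qed (simp_all only: S root pos)
  with ij(2) show thesis using that[of "j - i" i] by simp
qed

section \<open>Recurrences with periodic coefficients\<close>

text \<open>
  The coefficients \<open>\<alpha>, \<beta>, \<gamma>, \<delta>\<close> do not depend on \<open>u\<close>, which makes
  them usable for a solution and its shift by a
  period at once.
\<close>
lemma recurrence_transfer_coeffs:
  fixes a :: "nat \<Rightarrow> int"
  shows "\<exists>\<alpha> \<beta> \<gamma> \<delta>. \<forall>u. (\<forall>n\<ge>m. u (Suc (Suc n)) = a (Suc (Suc n)) * u (Suc n) + u n) \<longrightarrow>
           u (m + j) = \<alpha> * u m + \<beta> * u (Suc m) \<and> u (Suc (m + j)) = \<gamma> * u m + \<delta> * u (Suc m)"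
proof (induction j)
  case 0
  show ?case by (intro exI[of _ 1] exI[of _ 0]) simp
next
  case (Suc j)
  then obtain \<alpha> \<beta> \<gamma> \<delta> where IH: "\<And>u. \<forall>n\<ge>m. u (Suc (Suc n)) = a (Suc (Suc n)) * u (Suc n) + u n \<Longrightarrow>
      u (m + j) = \<alpha> * u m + \<beta> * u (Suc m) \<and> u (Suc (m + j)) = \<gamma> * u m + \<delta> * u (Suc m)"
    by blast
  let ?c = "a (Suc (Suc (m + j)))"
  show ?case
  proof (rule exI[of _ \<gamma>], rule exI[of _ \<delta>], rule exI[of _ "?c * \<gamma> + \<alpha>"],
      rule exI[of _ "?c * \<delta> + \<beta>"], intro allI impI)
    fix u assume u: "\<forall>n\<ge>m. u (Suc (Suc n)) = a (Suc (Suc n)) * u (Suc n) + u n"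
    hence "u (Suc (Suc (m + j))) = ?c * u (Suc (m + j)) + u (m + j)" by simp
    with IH[OF u] show "u (m + Suc j) = \<gamma> * u m + \<delta> * u (Suc m) \<and>
        u (Suc (m + Suc j)) = (?c * \<gamma> + \<alpha>) * u m + (?c * \<delta> + \<beta>) * u (Suc m)"
      by (simp add: algebra_simps)
  qed
qed

text \<open>
  Cayley and Hamilton for the transfer matrix over one period gives the relation at \<open>m\<close> and
  \<open>Suc m\<close>. The shifts of \<open>u\<close> by \<open>k\<close> and \<open>2 * k\<close> solve the recurrence of \<open>u\<close> because its
  coefficients are periodic, so the left-hand side solves it too and its two initial zeros
  propagate.
\<close>
lemma periodic_recurrence_constant_coeffs:
  fixes a u :: "nat \<Rightarrow> int"
  assumes rec: "\<And>n. n \<ge> m \<Longrightarrow> u (Suc (Suc n)) = a (Suc (Suc n)) * u (Suc n) + u n"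
    and per: "\<And>n. n \<ge> m \<Longrightarrow> a (n + k) = a n"
  obtains T d where "\<And>n. n \<ge> m \<Longrightarrow> u (n + 2 * k) - T * u (n + k) + d * u n = 0"
proof -
  obtain \<alpha> \<beta> \<gamma> \<delta> where transfer:
    "\<And>u. \<forall>n\<ge>m. u (Suc (Suc n)) = a (Suc (Suc n)) * u (Suc n) + u n \<Longrightarrow>
      u (m + k) = \<alpha> * u m + \<beta> * u (Suc m) \<and> u (Suc (m + k)) = \<gamma> * u m + \<delta> * u (Suc m)"
    using recurrence_transfer_coeffs[of m a k] by blast
  have reck: "u (Suc (Suc (n + k))) = a (Suc (Suc n)) * u (Suc (n + k)) + u (n + k)" if "n \<ge> m" for n
    using rec[of "n + k"] per[of "Suc (Suc n)"] that by simp
  have rec2k: "u (Suc (Suc (n + 2 * k))) = a (Suc (Suc n)) * u (Suc (n + 2 * k)) + u (n + 2 * k)"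
    if "n \<ge> m" for n
    using reck[of "n + k"] per[of "Suc (Suc n)"] that by (simp add: mult_2 add.assoc)
  have t1: "u (m + k) = \<alpha> * u m + \<beta> * u (Suc m)" "u (Suc (m + k)) = \<gamma> * u m + \<delta> * u (Suc m)"
    using transfer[of u] rec by blast+
  have t2: "u (m + 2 * k) = \<alpha> * u (m + k) + \<beta> * u (Suc (m + k))"
    "u (Suc (m + 2 * k)) = \<gamma> * u (m + k) + \<delta> * u (Suc (m + k))"
    using transfer[of "\<lambda>n. u (n + k)"] reck by (simp_all add: mult_2 add.assoc)
  define T d where "T = \<alpha> + \<delta>" and "d = \<alpha> * \<delta> - \<beta> * \<gamma>"
  define w where "w n = u (n + 2 * k) - T * u (n + k) + d * u n" for n
  have w0: "w m = 0"
    unfolding w_def T_def d_def t2 t1 by (simp add: algebra_simps)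
  have w1: "w (Suc m) = 0"
    unfolding w_def T_def d_def add_Suc t2 t1 by (simp add: algebra_simps)
  have w: "w n = 0 \<and> w (Suc n) = 0" if "n \<ge> m" for n
    using that
  proof (induction n rule: dec_induct)
    case base
    show ?case using w0 w1 by simp
  next
    case (step n)
    have "w (Suc (Suc n)) = a (Suc (Suc n)) * w (Suc n) + w n"
      unfolding w_def add_Suc rec[OF step.hyps(1)] reck[OF step.hyps(1)] rec2k[OF step.hyps(1)]
      by (simp add: algebra_simps)
    with step.IH show ?case by simp
  qed
  thus thesis using that[of T d] w_def by simp
qed

lemma fps_of_poly_of_int_nth:
  "fps_of_poly (map_poly of_int (P :: int poly)) $ n = (of_int (coeff P n) :: rat)"
  by (simp add: coeff_map_poly)

text \<open>
  Multiplying the generating function by \<open>1 - T z\<^sup>k + d z\<^bsup>2k\<^esup>\<close> turns the recurrence into the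
  vanishing of all coefficients from \<open>m + 2 * k\<close> on, which leaves a polynomial. The constant
  coefficient of this denominator is \<open>1\<close> because \<open>k > 0\<close>.
\<close>
lemma rational_over_int_if_constant_recurrence:
  fixes u :: "nat \<Rightarrow> int"
  assumes k: "k > 0" and rec: "\<And>n. n \<ge> m \<Longrightarrow> u (n + 2 * k) - T * u (n + k) + d * u n = 0"
  shows "rational_over_int (generating_function u)"
proof -
  define Q :: "int poly" where "Q = 1 - monom T k + monom d (2 * k)"
  let ?Q = "fps_of_poly (map_poly of_int Q) :: rat fps"
  define c where "c n = u n - (if n < k then 0 else T * u (n - k))
      + (if n < 2 * k then 0 else d * u (n - 2 * k))" for n
  have Q0: "coeff Q 0 = 1" using k by (simp add: Q_def)
  have Q: "?Q = 1 - fps_const (of_int T) * fps_X ^ k + fps_const (of_int d) * fps_X ^ (2 * k)"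
    by (rule fps_ext) (auto simp: Q_def coeff_map_poly fps_X_power_nth)
  have "generating_function u * ?Q = generating_function u
      - fps_const (of_int T) * (fps_X ^ k * generating_function u)
      + fps_const (of_int d) * (fps_X ^ (2 * k) * generating_function u)"
    unfolding Q by (simp only: ring_distribs mult_1_left mult_1_right mult_ac)
  hence nth: "(generating_function u * ?Q) $ n = of_int (c n)" for n
    by (simp add: generating_function_def c_def fps_X_power_mult_nth)
  have c0: "c n = 0" if "n \<ge> m + 2 * k" for n
  proof -
    define l where "l = n - 2 * k"
    have l: "n = l + 2 * k" "l \<ge> m" using that by (simp_all add: l_def)
    have "n - k = l + k" "n - 2 * k = l" using l(1) by simp_all
    thus ?thesis using rec[OF l(2)] l(1) by (simp add: c_def add.commute)
  qed
  define P where "P = Poly (map c [0..<m + 2 * k])"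
  have "coeff P n = c n" for n
    using c0[of n] by (simp add: P_def nth_default_def)
  hence "generating_function u * ?Q = fps_of_poly (map_poly of_int P)"
    by (intro fps_ext) (simp only: nth fps_of_poly_of_int_nth)
  moreover have "?Q \<noteq> 0"
    using Q0 by (metis fps_of_poly_of_int_nth fps_zero_nth of_int_1 zero_neq_one)
  ultimately have "generating_function u = fps_of_poly (map_poly of_int P) / ?Q"
    by (metis nonzero_mult_div_cancel_right)
  with Q0 show ?thesis unfolding rational_over_int_def by (intro exI[of _ P] exI[of _ Q]) simp
qed

theorem theorem1p1:
  fixes \<theta> :: real
  assumes "\<theta> \<notin> \<rat>" and "quadratic_irrational \<theta>"
  shows "rational_over_int (generating_function (cf_num \<theta>)) \<and>
         rational_over_int (generating_function (cf_denom \<theta>))"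
proof -
  obtain m k where k: "k > 0"
    and mk: "cf_complete_quotient \<theta> (m + k) = cf_complete_quotient \<theta> m"
    using cf_complete_quotient_recurs[OF assms] .
  have per: "cf_partial_quotient \<theta> (n + k) = cf_partial_quotient \<theta> n" if "n \<ge> m" for n
    using cf_complete_quotient_periodic[OF mk that] by (simp add: cf_partial_quotient_def)
  have "rational_over_int (generating_function u)"
    if rec: "\<And>n. u (Suc (Suc n)) = cf_partial_quotient \<theta> (Suc (Suc n)) * u (Suc n) + u n" for u
  proof -
    obtain T d where "\<And>n. n \<ge> m \<Longrightarrow> u (n + 2 * k) - T * u (n + k) + d * u n = 0"
      using periodic_recurrence_constant_coeffs[of m u "cf_partial_quotient \<theta>" k, OF rec per]
      by blast
    thus ?thesis by (rule rational_over_int_if_constant_recurrence[OF k])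
  qed
  thus ?thesis by simp
qed

end
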